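(* Let $u\colon\mathcal X\to\mathbb R$ and let $x\in\mathcal X\setminus\mathcal O$, with neighbors $\{y_1,\dots,y_n\}$ (so $\mathcal N_x=\{y_1,\dots,y_n\}$, $|\mathcal N_x|=n$). Assume that $u(y_1)\le\dots\le u(y_n)$. Then $$\lambda_i[u](x)=\frac12\bigl(u(y_{2i-1})+u(y_{2i})\bigr)-u(x),\qquad i\in\{1,\dots,n/2\}.$$
   Context: $\mathcal G=(\mathcal X,E)$ is a finite simple undirected graph, $\mathcal O\subseteq\mathcal X$ is the set of boundary vertices, and $\mathcal N_x$ is the set of neighbors of $x$. There is a fixed even integer $n\ge2$ with $|\mathcal N_x|=n$ for every $x\in\mathcal X\setminus\mathcal O$ (no degree condition on vertices of $\mathcal O$). For $u\colon\mathcal X\to\mathbb R$, $x\in\mathcal X\setminus\mathcal O$ and $i\in\{1,\dots,n/2\}$, define $$\lambda_i[u](x)=\min_{\substack{S\subseteq\mathcal N_x\\ |S|=2i}}\Bigl(\max_{\substack{y,z\in S\\ y\ne z}}\frac{u(y)+u(z)}2-u(x)\Bigr).$$ *)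

theory Defs
  imports Complex_Main "Graph_Theory.Pair_Digraph"
begin

text \<open>
  A finite simple undirected graph is a \<open>pair_graph\<close>: finite, loop-free, and with a symmetric
  set \<open>parcs G\<close> of ordered pairs, the edge between \<open>x\<close> and \<open>y\<close> being present as both
  \<open>(x, y)\<close> and \<open>(y, x)\<close>.
\<close>

definition neighbors :: "'a pair_pre_digraph \<Rightarrow> 'a \<Rightarrow> 'a set" where
  "neighbors G x = {y. (x, y) \<in> parcs G}"

text \<open>
  The sets under \<open>Max\<close> and \<open>Min\<close> are finite and nonempty when \<open>G\<close> is finite and
  \<open>1 \<le> i\<close>, \<open>2 * i \<le> card (neighbors G x)\<close>; outside this range the value has no meaning.
\<close>

definition graph_lambda :: "'a pair_pre_digraph \<Rightarrow> nat \<Rightarrow> ('a \<Rightarrow> real) \<Rightarrow> 'a \<Rightarrow> real" where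
  "graph_lambda G i u x =
     Min {Max {(u y + u z) / 2 | y z. y \<in> S \<and> z \<in> S \<and> y \<noteq> z} - u x | S.
            S \<subseteq> neighbors G x \<and> card S = 2 * i}"

end

theory Submission
  imports Defs
begin

text \<open>For a fixed \<open>S\<close>, the inner maximum is the average of the two largest values
  of \<open>u\<close> on \<open>S\<close>, so the minimum asks how small the top two can be made by
  choosing 2i neighbors. Any 2i distinct indices in {1..n} include two distinct ones that are at
  least 2i-1 and 2i (\<open>exists_two_ge_card\<close>), so monotonicity bounds every maximum below
  by the average at 2i-1 and 2i. The first 2i neighbors attain this bound.
  \<open>Min_Max_pair_averages\<close> carries out the argument; the theorem only unfolds
  \<open>graph_lambda\<close>.\<close>

text \<open>A set of positive integers lies in {1..Max T}, so its maximum is a witness.\<close>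

lemma exists_ge_card:
  fixes T :: "nat set"
  assumes "finite T" "T \<noteq> {}" "0 \<notin> T"
  shows "\<exists>m\<in>T. card T \<le> m"
proof -
  have "T \<subseteq> {1..Max T}"
    using assms by (metis Max_ge One_nat_def Suc_leI atLeastAtMost_iff bot_nat_0.not_eq_extremum subsetI)
  then have "card T \<le> card {1..Max T}"
    by (intro card_mono) auto
  then show ?thesis
    using assms Max_in by auto
qed

text \<open>Remove one element \<open>m\<close> given by \<open>exists_ge_card\<close> and apply
  that lemma again to the remaining \<open>card T - 1\<close> elements.\<close>

lemma exists_two_ge_card:
  fixes T :: "nat set"
  assumes "finite T" "2 \<le> card T" "0 \<notin> T"
  shows "\<exists>p\<in>T. \<exists>m\<in>T. p \<noteq> m \<and> card T - 1 \<le> p \<and> card T \<le> m"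
proof -
  have "T \<noteq> {}" using assms by auto
  then obtain m where m: "m \<in> T" "card T \<le> m"
    using exists_ge_card assms by blast
  then have "card (T - {m}) = card T - 1"
    by simp
  moreover from this have "T - {m} \<noteq> {}"
    using assms by (metis card.empty diff_is_0_eq not_less_eq_eq numeral_2_eq_2 One_nat_def)
  ultimately show ?thesis
    using exists_ge_card[of "T - {m}"] assms m by auto
qed

lemma finite_pair_averages:
  assumes "finite S"
  shows "finite {(u y + u z) / (2::real) | y z. y \<in> S \<and> z \<in> S \<and> y \<noteq> z}"
proof (rule finite_subset)
  show "{(u y + u z) / 2 | y z. y \<in> S \<and> z \<in> S \<and> y \<noteq> z} \<subseteq> (\<lambda>(y, z). (u y + u z) / 2) ` (S \<times> S)"
    by force
  show "finite ((\<lambda>(y, z). (u y + u z) / 2) ` (S \<times> S))"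
    using assms by simp
qed

text \<open>The graph enters only through an enumerated set \<open>N\<close>, and \<open>u x\<close>
  only as a constant \<open>c\<close>. The proof compares indices rather than values, so ties among
  the values of \<open>u\<close> cause no trouble.\<close>

lemma Min_Max_pair_averages:
  fixes u :: "'a \<Rightarrow> real" and c :: real
  assumes y: "bij_betw y {1..n} N"
    and mono: "mono_on {1..n} (\<lambda>j. u (y j))"
    and i: "1 \<le> i" "2 * i \<le> n"
  shows "Min {Max {(u v + u w) / 2 | v w. v \<in> S \<and> w \<in> S \<and> v \<noteq> w} - c | S. S \<subseteq> N \<and> card S = 2 * i}
    = (u (y (2 * i - 1)) + u (y (2 * i))) / 2 - c"
proof -
  define P where "P S = {(u v + u w) / 2 | v w. v \<in> S \<and> w \<in> S \<and> v \<noteq> w}" for S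
  define a where "a = (u (y (2 * i - 1)) + u (y (2 * i))) / 2"
  have N: "N = y ` {1..n}" and inj: "inj_on y {1..n}"
    using y by (auto simp: bij_betw_def)
  have finP: "finite (P S)" if "S \<subseteq> N" for S
    unfolding P_def using that N by (intro finite_pair_averages) (auto intro: finite_subset)
  have le: "u (y j) \<le> u (y k)" if "1 \<le> j" "j \<le> k" "k \<le> n" for j k
    using mono_onD[OF mono, of j k] that by auto
  have lower: "a \<le> Max (P S)" if S: "S \<subseteq> N" "card S = 2 * i" for S
  proof -
    \<comment> \<open>Pass to the index set of \<open>S\<close>, which has the same cardinality
      because \<open>y\<close> is injective.\<close>
    obtain T where T: "T \<subseteq> {1..n}" "S = y ` T"
      using S(1) N by (auto simp: subset_image_iff)
    have injT: "inj_on y T"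
      using inj T(1) by (rule inj_on_subset)
    have cT: "card T = 2 * i"
      using S(2) T(2) card_image[OF injT] by simp
    have "finite T" "0 \<notin> T"
      using T(1) by (auto intro: finite_subset)
    then obtain p m where pm: "p \<in> T" "m \<in> T" "p \<noteq> m" "2 * i - 1 \<le> p" "2 * i \<le> m"
      using exists_two_ge_card[of T] cT i by auto
    \<comment> \<open>\<open>P S\<close> averages over distinct elements, so distinct indices must
      give distinct elements.\<close>
    have "y p \<noteq> y m"
      using pm injT by (auto dest: inj_onD)
    then have "(u (y p) + u (y m)) / 2 \<in> P S"
      unfolding P_def T(2) using pm by blast
    then have "(u (y p) + u (y m)) / 2 \<le> Max (P S)"
      using Max_ge[OF finP[OF S(1)]] by blast
    moreover have "a \<le> (u (y p) + u (y m)) / 2"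
      unfolding a_def using pm T(1) i by (intro divide_right_mono add_mono le) auto
    ultimately show ?thesis
      by (rule order_trans[rotated])
  qed
  \<comment> \<open>The minimizer: the neighbors with the 2i smallest indices.\<close>
  define S0 where "S0 = y ` {1..2 * i}"
  have S0: "S0 \<subseteq> N"
    using i by (auto simp: S0_def N)
  have inj0: "inj_on y {1..2 * i}"
    using inj i by (auto intro: inj_on_subset)
  have cS0: "card S0 = 2 * i"
    using card_image[OF inj0] by (simp add: S0_def)
  \<comment> \<open>Since i is at least 1, the truncated subtraction 2i-1 is a genuine predecessor
    and a valid index.\<close>
  have idx: "2 * i - 1 \<in> {1..2 * i}" "2 * i \<in> {1..2 * i}" "2 * i - 1 \<noteq> 2 * i"
    using i by simp_all
  then have "y (2 * i - 1) \<noteq> y (2 * i)"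
    using inj_onD[OF inj0] by metis
  then have aP: "a \<in> P S0"
    unfolding P_def a_def S0_def using idx(1,2) by blast
  have upper: "b \<le> a" if "b \<in> P S0" for b
  proof -
    obtain j k where jk: "j \<in> {1..2 * i}" "k \<in> {1..2 * i}" "j \<noteq> k" "b = (u (y j) + u (y k)) / 2"
      using \<open>b \<in> P S0\<close> unfolding P_def S0_def by blast
    \<comment> \<open>Two distinct indices up to 2i cannot both equal 2i, so one of them is at most
      2i-1; the two cases differ by swapping \<open>j\<close> and \<open>k\<close>.\<close>
    consider "j \<le> 2 * i - 1" "k \<le> 2 * i" | "k \<le> 2 * i - 1" "j \<le> 2 * i"
      using jk by fastforce
    then have "u (y j) + u (y k) \<le> u (y (2 * i - 1)) + u (y (2 * i))"
    proof cases
      case 1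
      then show ?thesis
        using jk i by (intro add_mono le) auto
    next
      case 2
      then have "u (y k) + u (y j) \<le> u (y (2 * i - 1)) + u (y (2 * i))"
        using jk i by (intro add_mono le) auto
      then show ?thesis
        by (simp only: add.commute)
    qed
    then show ?thesis
      using jk by (simp add: a_def)
  qed
  have "Max (P S0) = a"
    using aP upper finP[OF S0] by (intro Max_eqI) auto
  \<comment> \<open>The value a - c is attained at \<open>S0\<close> and is a lower bound by
    \<open>lower\<close>; the family of candidates is finite because \<open>N\<close> is.\<close>
  then have "Min {Max (P S) - c | S. S \<subseteq> N \<and> card S = 2 * i} = a - c"
    using lower S0 cS0 by (intro Min_eqI) (auto simp: N)
  then show ?thesis
    unfolding P_def a_def .
qed

theorem lemma2p2:
  fixes G :: "'a pair_pre_digraph" and Bd :: "'a set" and n i :: nat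
    and u :: "'a \<Rightarrow> real" and x :: 'a and y :: "nat \<Rightarrow> 'a"
  assumes "pair_graph G"
    and "Bd \<subseteq> pverts G"
    and "even n" and "n \<ge> 2"
    and "\<forall>v \<in> pverts G - Bd. card (neighbors G v) = n"
    and "x \<in> pverts G - Bd"
    and "bij_betw y {1..n} (neighbors G x)"
    and "mono_on {1..n} (\<lambda>j. u (y j))"
    and "i \<in> {1..n div 2}"
  shows "graph_lambda G i u x = (1/2) * (u (y (2 * i - 1)) + u (y (2 * i))) - u x"
proof -
  have "1 \<le> i" "2 * i \<le> n"
    using assms(9) by auto
  from Min_Max_pair_averages[OF assms(7,8) this, of "u x"] show ?thesis
    by (simp add: graph_lambda_def)
qed

end
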